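(* Let $P$ be a finite poset and $\mathbb{K}$ a field. Let $R=\mathbb{K}[\{y_g: g\in\mathcal{A}^{(e)}(P)\}]$ and let $I_{\mathcal{C}^{(e)}(P)}$ be the ideal of $R$ generated by all squarefree monomials $y_gy_h$ satisfying either of the following conditions: (i) there exists $v\in\operatorname{supp}(g)\cap\operatorname{supp}(h)$ such that $g(v)\neq h(v)$; (ii) $\langle\operatorname{supp}(g)\rangle\not\subseteq\langle\operatorname{supp}(h)\rangle$, $\langle\operatorname{supp}(g)\rangle\not\supseteq\langle\operatorname{supp}(h)\rangle$, and $g(v)=h(v)$ for any $v\in\operatorname{supp}(g)\cap\operatorname{supp}(h)$. Then $\Delta(I_{\mathcal{C}^{(e)}(P)})=\mathcal{T}^{(e)}_P$, where $\mathcal{T}^{(e)}_P=\{\operatorname{conv}\Phi^{(e)}(K): K\text{ is a chain in }\mathcal{F}^{(e)}(P)\}$ and a face $\sigma\subset\mathcal{A}^{(e)}(P)$ of $\Delta(I_{\mathcal{C}^{(e)}(P)})$ is identified with the simplex $\operatorname{conv}\sigma$.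
   Context: For $f:P\to\mathbb{R}$, $\operatorname{supp}(f)=\{v\in P: f(v)\neq 0\}$. An order filter of $P$ is a subset $F\subset P$ such that $v\in F$ and $v<w$ imply $w\in F$. For an antichain $A$, $\langle A\rangle$ is the smallest order filter containing $A$. $\mathcal{A}^{(e)}(P)$ is the set of $g:P\to\{1,0,-1\}$ whose support is an antichain of $P$. $\mathcal{F}^{(e)}(P)$ is the set of $f:P\to\{1,0,-1\}$ such that $\operatorname{supp}(f)$ is an order filter of $P$, and if $f(v)=-1$ then $v$ is minimal in $\operatorname{supp}(f)$. It is partially ordered: $f>g$ if (i) $\operatorname{supp}(f)\supsetneq\operatorname{supp}(g)$; (ii) $f(v)\ge g(v)$ for any $v\in\operatorname{supp}(g)$; (iii) if $v\in\operatorname{supp}(g)$ and $v$ is minimal in $\operatorname{supp}(f)$, then $f(v)=g(v)$. Chains in $\mathcal{F}^{(e)}(P)$ include the empty chain. The enriched transfer map $\Phi^{(e)}:\mathbb{R}^P\to\mathbb{R}^P$ is defined inductively by $(\Phi^{(e)}f)(v)=f(v)$ if $v$ is minimal in $P$, and $(\Phi^{(e)}f)(v)=f(v)-\max\{\sum_{i=1}^r|(\Phi^{(e)}f)(v_i)| : v>v_1>\dots>v_r \text{ a chain in } P\}$ otherwise. It maps $\mathcal{F}^{(e)}(P)$ bijectively onto $\mathcal{A}^{(e)}(P)$. For a simplicial complex $\Delta$ on a finite index set of variables, its Stanley–Reisner ideal $I_\Delta$ is generated by the squarefree monomials $\prod_{i\in F}y_i$ with $F\notin\Delta$. For a squarefree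 monomial ideal $I$, $\Delta(I)$ is the unique simplicial complex with $I=I_{\Delta(I)}$; here its vertices are elements of $\mathcal{A}^{(e)}(P)$. *)

theory Defs
  imports "HOL-Analysis.Analysis" "HOL-Library.Poly_Mapping" "HOL-Algebra.Ideal"
begin

section \<open>Finite posets and functions on them\<close>

text \<open>
  A finite poset is a subset \<open>P\<close> (possibly empty) of a finite ordered type \<open>'a\<close>, with the induced
  order.  The space of real functions on \<open>P\<close> is the coordinate subspace of \<open>real ^ 'a\<close> of
  vectors that vanish outside \<open>P\<close>.
\<close>

definition functions_on :: "'a::finite set \<Rightarrow> (real, 'a) vec set" where
  "functions_on P = {f. \<forall>v. v \<notin> P \<longrightarrow> f $ v = 0}"

definition supp :: "(real, 'a::finite) vec \<Rightarrow> 'a set" where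
  "supp f = {v. f $ v \<noteq> 0}"

definition antichain :: "'a::order set \<Rightarrow> bool" where
  "antichain A \<longleftrightarrow> (\<forall>v\<in>A. \<forall>w\<in>A. \<not> v < w)"

definition minimal_in :: "'a::order set \<Rightarrow> 'a \<Rightarrow> bool" where
  "minimal_in S v \<longleftrightarrow> v \<in> S \<and> (\<forall>w\<in>S. \<not> w < v)"

definition order_filter :: "'a::order set \<Rightarrow> 'a set \<Rightarrow> bool" where
  "order_filter P F \<longleftrightarrow> F \<subseteq> P \<and> (\<forall>v\<in>F. \<forall>w\<in>P. v < w \<longrightarrow> w \<in> F)"

definition generated_filter :: "'a::order set \<Rightarrow> 'a set \<Rightarrow> 'a set" where
  "generated_filter P A = order_filter P hull A"

definition enriched_antichains :: "'a::{finite,order} set \<Rightarrow> (real, 'a) vec set" where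
  "enriched_antichains P =
    {g \<in> functions_on P. (\<forall>v\<in>P. g $ v \<in> {1, 0, -1}) \<and> antichain (supp g)}"

definition enriched_filters :: "'a::{finite,order} set \<Rightarrow> (real, 'a) vec set" where
  "enriched_filters P =
    {f \<in> functions_on P. (\<forall>v\<in>P. f $ v \<in> {1, 0, -1}) \<and> order_filter P (supp f) \<and>
       (\<forall>v\<in>P. f $ v = -1 \<longrightarrow> minimal_in (supp f) v)}"

definition enriched_greater :: "(real, 'a::{finite,order}) vec \<Rightarrow> (real, 'a) vec \<Rightarrow> bool" where
  "enriched_greater f g \<longleftrightarrow>
     supp g \<subset> supp f \<and>
     (\<forall>v\<in>supp g. f $ v \<ge> g $ v) \<and>
     (\<forall>v\<in>supp g. minimal_in (supp f) v \<longrightarrow> f $ v = g $ v)"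

section \<open>The enriched transfer map\<close>

text \<open>
  A chain \<open>v > v\<^sub>1 > \<dots> > v\<^sub>r\<close> with \<open>r \<ge> 1\<close> is encoded by the nonempty totally ordered
  set \<open>C = {v\<^sub>1, \<dots>, v\<^sub>r}\<close> of elements of \<open>P\<close> below \<open>v\<close>.  Only values at \<open>v \<in> P\<close> are
  meaningful; for a non-minimal \<open>v \<in> P\<close> the maximum ranges over a finite nonempty set.
\<close>

function enriched_transfer_value :: "'a::{finite,order} set \<Rightarrow> (real, 'a) vec \<Rightarrow> 'a \<Rightarrow> real" where
  "enriched_transfer_value P f v =
    (if minimal_in P v then f $ v
     else f $ v - Max ((\<lambda>C. \<Sum>u\<in>C. \<bar>enriched_transfer_value P f u\<bar>) `
                         {C. C \<noteq> {} \<and> pred_on.chain P (<) C \<and> (\<forall>u\<in>C. u < v)}))"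
  by pat_completeness auto
termination
proof (relation "Wellfounded.measure (\<lambda>(P, f, v). card {..<v})")
  fix P :: "'a set" and f :: "(real, 'a) vec" and v u :: 'a and C :: "'a set"
  assume "C \<in> {C. C \<noteq> {} \<and> pred_on.chain P (<) C \<and> (\<forall>u\<in>C. u < v)}" and "u \<in> C"
  then have "u < v" by blast
  then have "{..<u} \<subseteq> {..<v}" "u \<in> {..<v}" "u \<notin> {..<u}"
    by (auto dest: less_trans)
  then have "card {..<u} < card {..<v}"
    by (metis finite psubset_card_mono psubsetI)
  then show "((P, f, u), (P, f, v)) \<in> Wellfounded.measure (\<lambda>(P, f, v). card {..<v})"
    by simp
qed simp

declare enriched_transfer_value.simps [simp del]

definition enriched_transfer :: "'a::{finite,order} set \<Rightarrow> (real, 'a) vec \<Rightarrow> (real, 'a) vec" where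
  "enriched_transfer P f = (\<chi> v. if v \<in> P then enriched_transfer_value P f v else 0)"

definition enriched_triangulation :: "'a::{finite,order} set \<Rightarrow> (real, 'a) vec set set" where
  "enriched_triangulation P =
    {convex hull (enriched_transfer P ` K) | K.
       pred_on.chain (enriched_filters P) enriched_greater K}"

section \<open>Polynomial rings and Stanley--Reisner ideals\<close>

type_synonym ('v, 'k) polynomial = "('v \<Rightarrow>\<^sub>0 nat) \<Rightarrow>\<^sub>0 'k"

definition var :: "'v \<Rightarrow> ('v, 'k::comm_ring_1) polynomial" where
  "var i = Poly_Mapping.single (Poly_Mapping.single i 1) 1"

definition polynomial_ring :: "'v set \<Rightarrow> ('v, 'k::comm_ring_1) polynomial ring" where
  "polynomial_ring V =
    \<lparr>carrier = {p. \<forall>m\<in>Poly_Mapping.keys p. Poly_Mapping.keys m \<subseteq> V},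
     monoid.mult = (*), one = 1, zero = 0, add = (+)\<rparr>"

lemma polynomial_ring_simps [simp]:
  "p \<in> carrier (polynomial_ring V) \<longleftrightarrow>
     (\<forall>m\<in>Poly_Mapping.keys p. Poly_Mapping.keys m \<subseteq> V)"
  "p \<otimes>\<^bsub>polynomial_ring V\<^esub> q = p * q"
  "p \<oplus>\<^bsub>polynomial_ring V\<^esub> q = p + q"
  "\<one>\<^bsub>polynomial_ring V\<^esub> = 1"
  "\<zero>\<^bsub>polynomial_ring V\<^esub> = 0"
  by (simp_all add: polynomial_ring_def)

lemma polynomial_ring_add_closed:
  assumes "p \<in> carrier (polynomial_ring V)" "q \<in> carrier (polynomial_ring V)"
  shows "p + q \<in> carrier (polynomial_ring V)"
  using assms Poly_Mapping.keys_add[of p q] unfolding polynomial_ring_simps by blast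

lemma polynomial_ring_mult_closed:
  assumes "p \<in> carrier (polynomial_ring V)" "q \<in> carrier (polynomial_ring V)"
  shows "p * q \<in> carrier (polynomial_ring V)"
  unfolding polynomial_ring_simps
proof
  fix m assume "m \<in> Poly_Mapping.keys (p * q)"
  then obtain a b where m: "m = a + b" "a \<in> Poly_Mapping.keys p" "b \<in> Poly_Mapping.keys q"
    using Poly_Mapping.keys_mult[of p q] by blast
  then have "Poly_Mapping.keys a \<subseteq> V" "Poly_Mapping.keys b \<subseteq> V"
    using assms unfolding polynomial_ring_simps by blast+
  then show "Poly_Mapping.keys m \<subseteq> V"
    using Poly_Mapping.keys_add[of a b] m(1) by blast
qed

lemma cring_polynomial_ring: "cring (polynomial_ring V :: ('v, 'k::comm_ring_1) polynomial ring)"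
proof (rule cringI)
  let ?R = "polynomial_ring V :: ('v, 'k) polynomial ring"
  show "abelian_group ?R"
  proof (rule abelian_groupI)
    fix p q assume "p \<in> carrier ?R" "q \<in> carrier ?R"
    then show "p \<oplus>\<^bsub>?R\<^esub> q \<in> carrier ?R"
      using polynomial_ring_add_closed unfolding polynomial_ring_simps(3) by blast
  next
    fix p assume "p \<in> carrier ?R"
    then have "- p \<in> carrier ?R" by simp
    then show "\<exists>q\<in>carrier ?R. q \<oplus>\<^bsub>?R\<^esub> p = \<zero>\<^bsub>?R\<^esub>"
      by (rule bexI[rotated]) simp
  qed (simp_all add: add.assoc add.commute)
  show "comm_monoid ?R"
  proof (rule comm_monoidI)
    fix p q assume "p \<in> carrier ?R" "q \<in> carrier ?R"
    then show "p \<otimes>\<^bsub>?R\<^esub> q \<in> carrier ?R"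
      using polynomial_ring_mult_closed unfolding polynomial_ring_simps(2) by blast
  qed (simp_all add: mult.assoc mult.commute)
qed (simp add: distrib_right)

text \<open>Neither \<open>{} \<in> \<Delta>\<close> nor \<open>{i} \<in> \<Delta>\<close> is demanded, so that every squarefree monomial ideal,
  including the unit ideal and ideals containing variables, has a complex.\<close>

definition simplicial_complex_on :: "'v set \<Rightarrow> 'v set set \<Rightarrow> bool" where
  "simplicial_complex_on V \<Delta> \<longleftrightarrow> (\<forall>\<sigma>\<in>\<Delta>. \<sigma> \<subseteq> V \<and> (\<forall>\<tau>. \<tau> \<subseteq> \<sigma> \<longrightarrow> \<tau> \<in> \<Delta>))"

definition stanley_reisner_ideal ::
    "'v set \<Rightarrow> 'v set set \<Rightarrow> ('v, 'k::comm_ring_1) polynomial set" where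
  "stanley_reisner_ideal V \<Delta> =
    Idl\<^bsub>polynomial_ring V\<^esub> {\<Prod>i\<in>F. var i | F. F \<subseteq> V \<and> F \<notin> \<Delta>}"

definition stanley_reisner_complex ::
    "'v set \<Rightarrow> ('v, 'k::comm_ring_1) polynomial set \<Rightarrow> 'v set set" where
  "stanley_reisner_complex V I =
    (THE \<Delta>. simplicial_complex_on V \<Delta> \<and> I = stanley_reisner_ideal V \<Delta>)"

text \<open>The requirement \<open>g \<noteq> h\<close> says that \<open>y\<^sub>g y\<^sub>h\<close> is squarefree.\<close>

definition enriched_chain_ideal ::
    "'a::{finite,order} set \<Rightarrow> ((real, 'a) vec, 'k::field) polynomial set" where
  "enriched_chain_ideal P =
    Idl\<^bsub>polynomial_ring (enriched_antichains P)\<^esub>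
      {var g * var h | g h.
         g \<in> enriched_antichains P \<and> h \<in> enriched_antichains P \<and> g \<noteq> h \<and>
         ((\<exists>v\<in>supp g \<inter> supp h. g $ v \<noteq> h $ v) \<or>
          (\<not> generated_filter P (supp g) \<subseteq> generated_filter P (supp h) \<and>
           \<not> generated_filter P (supp g) \<supseteq> generated_filter P (supp h) \<and>
           (\<forall>v\<in>supp g \<inter> supp h. g $ v = h $ v)))}"

end

(*
  On an enriched filter f the transfer map keeps the values at the minimal elements of supp f and
  kills everything else, and f is recovered by putting 1 on the rest of the filter generated by
  supp (Phi f) = Min (supp f).  Under this bijection two distinct filters are comparable iff their
  images agree on the common support and generate nested filters, that is, iff the images form no
  generator y_g y_h of the ideal.  Hence the ideal is the edge ideal whose flag complex is the image
  of the chains.  Along a chain every antichain has an element outside all smaller filters, which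
  gives affine independence, so a face is the set of extreme points of its convex hull.
*)
theory Submission
  imports Defs
begin

section \<open>Stanley--Reisner ideals\<close>

text \<open>Natural exponents cannot cancel, so a product of monomials involves exactly the
  variables of its factors.\<close>

lemma keys_add_nat: "Poly_Mapping.keys (a + b) = Poly_Mapping.keys a \<union> Poly_Mapping.keys b"
  for a b :: "'v \<Rightarrow>\<^sub>0 nat"
  by (auto simp: in_keys_iff lookup_add)

text \<open>For infinite \<open>F\<close> the default values agree: the product is 1 and the
  exponent is 0.\<close>

lemma prod_var:
  "(\<Prod>i\<in>F. var i) = Poly_Mapping.single (\<Sum>i\<in>F. Poly_Mapping.single i 1) (1 :: 'k::comm_ring_1)"
  by (induction F rule: infinite_finite_induct)
    (simp_all add: var_def mult_single single_one flip: single_one)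

lemma keys_sum_single:
  "finite F \<Longrightarrow> Poly_Mapping.keys (\<Sum>i\<in>F. Poly_Mapping.single i (1::nat)) = F"
  by (induction F rule: finite_induct) (simp_all add: keys_add_nat)

lemma keys_prod_var:
  "Poly_Mapping.keys (\<Prod>i\<in>F. var i :: ('v, 'k::comm_ring_1) polynomial) =
     {\<Sum>i\<in>F. Poly_Mapping.single i 1}"
  by (simp add: prod_var)

lemma prod_var_closed:
  assumes "finite F" "F \<subseteq> V"
  shows "(\<Prod>i\<in>F. var i) \<in> carrier (polynomial_ring V :: ('v, 'k::comm_ring_1) polynomial ring)"
  using assms by (simp add: keys_prod_var keys_sum_single del: One_nat_def)

section \<open>Squarefree monomials in a Stanley-Reisner ideal\<close>

text \<open>Multiplication by a monomial only adds variables, and a set containing a nonface is a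
  nonface. This ideal serves as an upper bound for the Stanley-Reisner ideal.\<close>

lemma ideal_nonface_monomials:
  assumes "simplicial_complex_on V \<Delta>"
  shows "ideal {p \<in> carrier (polynomial_ring V). \<forall>m\<in>Poly_Mapping.keys p. Poly_Mapping.keys m \<notin> \<Delta>}
           (polynomial_ring V :: ('v, 'k::comm_ring_1) polynomial ring)"
    (is "ideal ?J ?R")
proof -
  interpret cring ?R by (rule cring_polynomial_ring)
  have mult: "p * q \<in> ?J" if "p \<in> ?J" "q \<in> carrier ?R" for p q
  proof -
    have "Poly_Mapping.keys m \<notin> \<Delta>" if m: "m \<in> Poly_Mapping.keys (p * q)" for m
    proof
      assume face: "Poly_Mapping.keys m \<in> \<Delta>"
      obtain a b where ab: "m = a + b" "a \<in> Poly_Mapping.keys p"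
        using Poly_Mapping.keys_mult[of p q] m by blast
      then have "Poly_Mapping.keys a \<subseteq> Poly_Mapping.keys m"
        by (simp add: keys_add_nat)
      then have "Poly_Mapping.keys a \<in> \<Delta>"
        using assms face unfolding simplicial_complex_on_def by simp
      then show False using \<open>p \<in> ?J\<close> ab(2) by simp
    qed
    moreover have "p * q \<in> carrier ?R"
      using that polynomial_ring_mult_closed by blast
    ultimately show ?thesis by blast
  qed
  show ?thesis
  proof (rule idealI)
    show "subgroup ?J (add_monoid ?R)"
    proof
      fix p q assume "p \<in> ?J" "q \<in> ?J"
      then have "p + q \<in> ?J"
        using polynomial_ring_add_closed[of p V q] Poly_Mapping.keys_add[of p q] by blast
      then show "p \<otimes>\<^bsub>add_monoid ?R\<^esub> q \<in> ?J" by (simp add: polynomial_ring_def)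
    next
      fix p assume p: "p \<in> ?J"
      then have "- p \<in> ?J" by simp
      moreover have "\<ominus>\<^bsub>?R\<^esub> p = - p"
        using p by (intro minus_equality) simp_all
      ultimately show "inv\<^bsub>add_monoid ?R\<^esub> p \<in> ?J" by (simp add: a_inv_def)
    qed (auto simp: polynomial_ring_def)
  next
    fix p q assume "p \<in> ?J" "q \<in> carrier ?R"
    then have "p * q \<in> ?J" by (rule mult)
    then show "p \<otimes>\<^bsub>?R\<^esub> q \<in> ?J" "q \<otimes>\<^bsub>?R\<^esub> p \<in> ?J"
      by (simp_all only: polynomial_ring_simps(2) mult.commute[of q p])
  qed (rule ring_axioms)
qed

text \<open>Nonface monomials are generators. A face monomial is kept out by the ideal of
  polynomials whose monomials all have nonface supports, since that ideal contains every
  generator.\<close>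

lemma prod_var_in_stanley_reisner_ideal_iff:
  assumes "finite V" "simplicial_complex_on V \<Delta>" "F \<subseteq> V"
  shows "(\<Prod>i\<in>F. var i) \<in> (stanley_reisner_ideal V \<Delta> :: ('v, 'k::comm_ring_1) polynomial set)
           \<longleftrightarrow> F \<notin> \<Delta>"
proof -
  let ?R = "polynomial_ring V :: ('v, 'k) polynomial ring"
  let ?S = "{\<Prod>i\<in>F. var i | F. F \<subseteq> V \<and> F \<notin> \<Delta>} :: ('v, 'k) polynomial set"
  let ?J = "{p \<in> carrier ?R. \<forall>m\<in>Poly_Mapping.keys p. Poly_Mapping.keys m \<notin> \<Delta>}"
  interpret cring ?R by (rule cring_polynomial_ring)
  have fin: "finite G" if "G \<subseteq> V" for G
    using that assms(1) finite_subset by blast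
  have closed: "?S \<subseteq> carrier ?R"
    using prod_var_closed fin by blast
  have "?S \<subseteq> ?J"
    using closed fin by (auto simp: keys_prod_var keys_sum_single simp del: One_nat_def)
  then have "stanley_reisner_ideal V \<Delta> \<subseteq> ?J"
    unfolding stanley_reisner_ideal_def
    by (intro genideal_minimal ideal_nonface_monomials assms)
  moreover have "?S \<subseteq> stanley_reisner_ideal V \<Delta>"
    unfolding stanley_reisner_ideal_def by (rule genideal_self[OF closed])
  moreover have "(\<Prod>i\<in>F. var i) \<in> ?J \<Longrightarrow> F \<notin> \<Delta>"
    using fin[OF assms(3)] by (simp add: keys_prod_var keys_sum_single del: One_nat_def)
  ultimately show ?thesis
    using assms(3) by blast
qed

text \<open>The squarefree monomials in the ideal determine which subsets of \<open>V\<close> are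
  faces; this is the uniqueness that \<open>THE\<close> needs.\<close>

lemma stanley_reisner_complex_of_ideal:
  assumes "finite V" "simplicial_complex_on V \<Delta>"
  shows "stanley_reisner_complex V
           (stanley_reisner_ideal V \<Delta> :: ('v, 'k::comm_ring_1) polynomial set) = \<Delta>"
  unfolding stanley_reisner_complex_def
proof (rule the_equality)
  fix \<Delta>' assume *: "simplicial_complex_on V \<Delta>' \<and>
    (stanley_reisner_ideal V \<Delta> :: ('v, 'k) polynomial set) = stanley_reisner_ideal V \<Delta>'"
  have "F \<in> \<Delta>' \<longleftrightarrow> F \<in> \<Delta>" if "F \<subseteq> V" for F
    using prod_var_in_stanley_reisner_ideal_iff[where 'k='k, OF assms that]
      prod_var_in_stanley_reisner_ideal_iff[where 'k='k, OF assms(1) _ that, of \<Delta>'] * by auto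
  moreover have "F \<subseteq> V" if "F \<in> \<Delta> \<or> F \<in> \<Delta>'" for F
    using that * assms(2) unfolding simplicial_complex_on_def by auto
  ultimately show "\<Delta>' = \<Delta>" by blast
qed (use assms in simp)

section \<open>Flag complexes and edge ideals\<close>

text \<open>The clique complex of a graph. As \<open>g\<close> and \<open>h\<close> occur in both
  orders, an asymmetric \<open>E\<close> contributes only its symmetric part.\<close>

definition flag_complex :: "'v set \<Rightarrow> ('v \<Rightarrow> 'v \<Rightarrow> bool) \<Rightarrow> 'v set set" where
  "flag_complex V E = {\<sigma>. \<sigma> \<subseteq> V \<and> (\<forall>g\<in>\<sigma>. \<forall>h\<in>\<sigma>. g \<noteq> h \<longrightarrow> E g h)}"

lemma flag_complexD:
  assumes "\<sigma> \<in> flag_complex V E"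
  shows "\<sigma> \<subseteq> V" "g \<in> \<sigma> \<Longrightarrow> h \<in> \<sigma> \<Longrightarrow> g \<noteq> h \<Longrightarrow> E g h"
  using assms unfolding flag_complex_def by simp_all

lemma simplicial_complex_on_flag_complex: "simplicial_complex_on V (flag_complex V E)"
  by (auto simp: simplicial_complex_on_def flag_complex_def subset_iff)

text \<open>Every nonface inside \<open>V\<close> contains a non-edge, so its monomial is a multiple
  of a quadratic generator; conversely a non-edge is a two-element nonface.\<close>

lemma edge_ideal_eq_stanley_reisner_ideal:
  assumes "finite V"
  shows "Idl\<^bsub>polynomial_ring V\<^esub> {var g * var h | g h. g \<in> V \<and> h \<in> V \<and> g \<noteq> h \<and> \<not> E g h} =
    (stanley_reisner_ideal V (flag_complex V E) :: ('v, 'k::comm_ring_1) polynomial set)"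
    (is "Idl\<^bsub>?R\<^esub> ?S = _")
proof -
  interpret cring ?R by (rule cring_polynomial_ring)
  let ?T = "{\<Prod>i\<in>F. var i | F. F \<subseteq> V \<and> F \<notin> flag_complex V E} :: ('v, 'k) polynomial set"
  have fin: "finite G" if "G \<subseteq> V" for G
    using that assms finite_subset by blast
  have pair: "var g * var h = (\<Prod>i\<in>{g, h}. var i)" if "g \<noteq> h" for g h :: 'v
    using that by simp
  have ST: "?S \<subseteq> ?T"
  proof
    fix p :: "('v, 'k) polynomial"
    assume "p \<in> ?S"
    then obtain g h where gh: "p = var g * var h" "g \<in> V" "h \<in> V" "g \<noteq> h" "\<not> E g h"
      by blast
    then have "{g, h} \<subseteq> V" "{g, h} \<notin> flag_complex V E"
      unfolding flag_complex_def by auto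
    then show "p \<in> ?T" using pair[OF gh(4)] gh(1) by blast
  qed
  have T: "?T \<subseteq> carrier ?R"
    using prod_var_closed fin by blast
  have S: "?S \<subseteq> carrier ?R" using ST T by blast
  interpret I: ideal "Idl\<^bsub>?R\<^esub> ?S" ?R by (rule genideal_ideal[OF S])
  have "?T \<subseteq> Idl\<^bsub>?R\<^esub> ?S"
  proof
    fix p :: "('v, 'k) polynomial"
    assume "p \<in> ?T"
    then obtain F where F: "p = (\<Prod>i\<in>F. var i)" "F \<subseteq> V" "F \<notin> flag_complex V E"
      by blast
    then obtain g h where gh: "g \<in> F" "h \<in> F" "g \<noteq> h" "\<not> E g h"
      unfolding flag_complex_def by blast
    have "p = (\<Prod>i\<in>F - {g, h}. var i) * (\<Prod>i\<in>{g, h}. var i)"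
      unfolding F(1) using gh fin[OF F(2)] by (intro prod.subset_diff) auto
    then have "p = (\<Prod>i\<in>F - {g, h}. var i) * (var g * var h)"
      unfolding pair[OF gh(3)] .
    moreover have "var g * var h \<in> Idl\<^bsub>?R\<^esub> ?S"
      using gh F(2) by (intro subsetD[OF genideal_self[OF S]]) blast
    moreover have "(\<Prod>i\<in>F - {g, h}. var i) \<in> carrier ?R"
      using fin F(2) by (intro prod_var_closed) blast+
    ultimately show "p \<in> Idl\<^bsub>?R\<^esub> ?S"
      using I.I_l_closed[of "var g * var h"] by simp
  qed
  then have "Idl\<^bsub>?R\<^esub> ?T \<subseteq> Idl\<^bsub>?R\<^esub> ?S"
    by (intro genideal_minimal I.ideal_axioms)
  moreover have "Idl\<^bsub>?R\<^esub> ?S \<subseteq> Idl\<^bsub>?R\<^esub> ?T"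
    using ST genideal_self[OF T] by (intro genideal_minimal genideal_ideal T) blast
  ultimately show ?thesis unfolding stanley_reisner_ideal_def by blast
qed

section \<open>Enriched filters and antichains\<close>

lemma subset_generated_filter: "A \<subseteq> generated_filter P A"
  unfolding generated_filter_def by (rule hull_subset)

text \<open>The inclusion in \<open>P\<close> matters: a set not inside \<open>P\<close> lies in no
  filter, and its hull would be the whole type.\<close>

lemma generated_filter_eq:
  assumes "A \<subseteq> P"
  shows "generated_filter P A = {w \<in> P. \<exists>v\<in>A. v \<le> w}"
  unfolding generated_filter_def
proof (rule hull_unique)
  show "order_filter P {w \<in> P. \<exists>v\<in>A. v \<le> w}"
    unfolding order_filter_def by (auto dest: order_le_less_trans less_imp_le)
next
  fix F assume "A \<subseteq> F" "order_filter P F"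
  then show "{w \<in> P. \<exists>v\<in>A. v \<le> w} \<subseteq> F"
    unfolding order_filter_def order_le_less by blast
qed (use assms in auto)

lemma minimal_in_below:
  fixes v :: "'a::{finite,order}"
  assumes "v \<in> S"
  obtains m where "minimal_in S m" "m \<le> v"
proof -
  obtain m where "m \<in> S" "m \<le> v" "\<forall>b\<in>S. b \<le> m \<longrightarrow> m = b"
    using finite_has_minimal2[OF finite assms] by blast
  then show thesis
    using that unfolding minimal_in_def by (metis less_imp_le less_irrefl)
qed

text \<open>A minimal element lies above some element of \<open>A\<close>, itself in the filter, and
  so equals it. Conversely, a filter element strictly below a member of \<open>A\<close> would put
  two members of \<open>A\<close> in strict order.\<close>

lemma minimal_in_generated_filter_iff:
  assumes "A \<subseteq> P" "antichain A"
  shows "minimal_in (generated_filter P A) v \<longleftrightarrow> v \<in> A"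
proof -
  have "v \<in> A" if v: "v \<in> P" "\<forall>w\<in>P. (\<exists>a\<in>A. a \<le> w) \<longrightarrow> \<not> w < v" and a: "a \<in> A" "a \<le> v" for a
    using v a assms(1) by (metis order_le_less order_refl subsetD)
  moreover have "\<not> w < v" if v: "v \<in> A" and a: "a \<in> A" "a \<le> w" for a w
    using v a assms(2) unfolding antichain_def by (meson order_le_less_trans)
  ultimately show ?thesis
    using assms(1) unfolding generated_filter_eq[OF assms(1)] minimal_in_def by blast
qed

text \<open>By finiteness every element of \<open>F\<close> has a minimal element of
  \<open>F\<close> below it.\<close>

lemma order_filter_generated_by_minimal:
  fixes F :: "'a::{finite,order} set"
  assumes "order_filter P F"
  shows "generated_filter P {v. minimal_in F v} = F"
proof -
  have "{v. minimal_in F v} \<subseteq> P"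
    using assms unfolding order_filter_def minimal_in_def by blast
  moreover have "w \<in> F" if "w \<in> P" "minimal_in F v" "v \<le> w" for v w
    using that assms unfolding order_filter_def minimal_in_def order_le_less by blast
  moreover have "\<exists>v. minimal_in F v \<and> v \<le> w" if "w \<in> F" for w
    using minimal_in_below[OF that] by blast
  moreover have "F \<subseteq> P"
    using assms unfolding order_filter_def by blast
  ultimately show ?thesis
    by (subst generated_filter_eq) auto
qed

section \<open>The transfer map on enriched filters\<close>

text \<open>Minimal elements of \<open>S\<close> are pairwise incomparable, so the chain contains at
  most one. This bounds the maximum in the recursion for the transfer map.\<close>

lemma sum_minimal_values_on_chain_le_1:
  fixes f :: "(real, 'a::{finite,order}) vec"
  assumes "pred_on.chain P (<) C" "\<And>u. \<bar>f $ u\<bar> \<le> 1"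
  shows "(\<Sum>u\<in>C. \<bar>if minimal_in S u then f $ u else 0\<bar>) \<le> 1"
proof (cases "\<exists>m\<in>C. minimal_in S m")
  case True
  then obtain m where m: "m \<in> C" "minimal_in S m" by blast
  have "\<not> minimal_in S u" if "u \<in> C" "u \<noteq> m" for u
    using assms(1) m that unfolding pred_on.chain_def minimal_in_def by blast
  then have "(\<Sum>u\<in>C. \<bar>if minimal_in S u then f $ u else 0\<bar>) = (\<Sum>u\<in>{m}. \<bar>f $ u\<bar>)"
    using m by (intro sum.mono_neutral_cong_right) auto
  then show ?thesis using assms(2) by simp
qed simp

lemma supp_subset: "f \<in> functions_on P \<Longrightarrow> supp f \<subseteq> P"
  unfolding functions_on_def supp_def by blast

lemma enriched_filters_values:
  assumes "f \<in> enriched_filters P"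
  shows "f $ v \<in> {1, 0, -1}" "\<bar>f $ v\<bar> \<le> 1" "v \<in> supp f \<Longrightarrow> \<not> minimal_in (supp f) v \<Longrightarrow> f $ v = 1"
proof -
  show "f $ v \<in> {1, 0, -1}"
    using assms unfolding enriched_filters_def functions_on_def by (cases "v \<in> P") auto
  then show "\<bar>f $ v\<bar> \<le> 1" by auto
  show "f $ v = 1" if "v \<in> supp f" "\<not> minimal_in (supp f) v"
    using that assms \<open>f $ v \<in> _\<close> supp_subset[of f P] unfolding enriched_filters_def supp_def by auto
qed

text \<open>Below \<open>v\<close>, by induction, only values at minimal elements of the support
  survive. The maximum is then 1 if \<open>v\<close> lies strictly above a support element, where it
  cancels \<open>f $ v = 1\<close>, and 0 otherwise.\<close>

lemma enriched_transfer_value_filter: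
  assumes f: "f \<in> enriched_filters P" and "v \<in> P"
  shows "enriched_transfer_value P f v = (if minimal_in (supp f) v then f $ v else 0)"
  using \<open>v \<in> P\<close>
\<comment> \<open>The number of elements strictly below \<open>v\<close> is also the measure by
  which the recursion terminates.\<close>
proof (induction v rule: measure_induct_rule[of "\<lambda>v. card {..<v}"])
  case (less v)
  have filter: "order_filter P (supp f)" and sub: "supp f \<subseteq> P"
    using f supp_subset unfolding enriched_filters_def by blast+
  have below: "enriched_transfer_value P f u = (if minimal_in (supp f) u then f $ u else 0)"
    if "u < v" "u \<in> P" for u
  proof -
    have "{..<u} \<subset> {..<v}" using that by (auto dest: less_trans)
    then show ?thesis using less.IH that by (simp add: psubset_card_mono)
  qed
  show ?case
  proof (cases "minimal_in P v")
    case True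
    then have "minimal_in (supp f) v" if "f $ v \<noteq> 0"
      using that sub unfolding minimal_in_def supp_def by blast
    then show ?thesis
      using True by (subst enriched_transfer_value.simps) auto
  next
    case False
    let ?S = "{C. C \<noteq> {} \<and> pred_on.chain P (<) C \<and> (\<forall>u\<in>C. u < v)}"
    let ?s = "\<lambda>C. \<Sum>u\<in>C. \<bar>if minimal_in (supp f) u then f $ u else 0\<bar>"
    have single: "{u} \<in> ?S" if "u \<in> P" "u < v" for u
      using that unfolding pred_on.chain_def by simp
    have "(\<Sum>u\<in>C. \<bar>enriched_transfer_value P f u\<bar>) = ?s C" if "C \<in> ?S" for C
      using that below by (intro sum.cong) (auto simp: pred_on.chain_def)
    then have eq: "enriched_transfer_value P f v = f $ v - Max (?s ` ?S)"
      using False by (subst enriched_transfer_value.simps) (auto intro!: arg_cong[where f=Max] image_cong)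
    show ?thesis
    proof (cases "\<exists>w\<in>supp f. w < v")
      case True
      then obtain m where m: "minimal_in (supp f) m" "m < v"
        by (metis minimal_in_below order_le_less_trans)
      then have mS: "m \<in> supp f" unfolding minimal_in_def by blast
      then have v: "v \<in> supp f" "\<not> minimal_in (supp f) v"
        using filter m(2) less.prems unfolding order_filter_def minimal_in_def by blast+
      have "\<bar>f $ m\<bar> = 1"
        using enriched_filters_values(1)[OF f, of m] mS unfolding supp_def by auto
      \<comment> \<open>The one-element chain \<open>{m}\<close> attains the upper bound 1, so the
        maximum is exactly 1.\<close>
      then have "?s {m} = 1" using m(1) by simp
      then have "1 \<in> ?s ` ?S"
        using single m(2) mS sub by (metis (no_types, lifting) image_eqI subsetD)
      moreover have "x \<le> 1" if "x \<in> ?s ` ?S" for x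
        using that sum_minimal_values_on_chain_le_1[of P _ f] enriched_filters_values(2)[OF f]
        by blast
      ultimately have "Max (?s ` ?S) = 1" by (intro Max_eqI) auto
      then show ?thesis using eq v enriched_filters_values(3)[OF f v] by simp
    next
      case no: False
      have "?s C = 0" if "C \<in> ?S" for C
        using that no by (intro sum.neutral) (auto simp: minimal_in_def)
      \<comment> \<open>As \<open>v\<close> is not minimal in \<open>P\<close>, some one-element
        chain lies below it, so the maximum is over \<open>{0}\<close> and not over the empty
        set.\<close>
      moreover have "?S \<noteq> {}"
        using False less.prems single unfolding minimal_in_def by blast
      ultimately have "?s ` ?S = {0}" by (auto simp: image_iff)
      then have "enriched_transfer_value P f v = f $ v" using eq by simp
      moreover have "minimal_in (supp f) v" if "f $ v \<noteq> 0"
        using that no unfolding minimal_in_def supp_def by blast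
      ultimately show ?thesis by auto
    qed
  qed
qed

lemma enriched_transfer_nth:
  assumes "f \<in> enriched_filters P"
  shows "enriched_transfer P f $ v = (if minimal_in (supp f) v then f $ v else 0)"
proof (cases "v \<in> P")
  case False
  then have "\<not> minimal_in (supp f) v"
    using assms supp_subset[of f P] unfolding enriched_filters_def minimal_in_def by blast
  then show ?thesis using False by (simp add: enriched_transfer_def)
qed (simp add: enriched_transfer_def enriched_transfer_value_filter[OF assms])

lemma supp_enriched_transfer:
  assumes "f \<in> enriched_filters P"
  shows "supp (enriched_transfer P f) = {v. minimal_in (supp f) v}"
  unfolding supp_def[of "enriched_transfer P f"] enriched_transfer_nth[OF assms]
  by (auto simp: minimal_in_def supp_def)

lemma generated_filter_enriched_transfer:
  assumes "f \<in> enriched_filters P"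
  shows "generated_filter P (supp (enriched_transfer P f)) = supp f"
  using assms order_filter_generated_by_minimal[of P "supp f"]
  unfolding supp_enriched_transfer[OF assms] enriched_filters_def by blast

section \<open>Bijection between enriched filters and enriched antichains\<close>

text \<open>The image determines the support, as the filter it generates, and the values at minimal
  elements; all other values on the support are 1.\<close>

lemma bij_betw_enriched_transfer:
  "bij_betw (enriched_transfer P) (enriched_filters P) (enriched_antichains P)"
proof (rule bij_betw_imageI)
  show "inj_on (enriched_transfer P) (enriched_filters P)"
  proof (rule inj_onI)
    fix f g assume f: "f \<in> enriched_filters P" and g: "g \<in> enriched_filters P"
      and eq: "enriched_transfer P f = enriched_transfer P g"
    have supp: "supp f = supp g"
      using generated_filter_enriched_transfer[OF f] generated_filter_enriched_transfer[OF g] eq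
      by simp
    have "f $ v = g $ v" for v
    proof -
      consider "minimal_in (supp f) v" | "v \<in> supp f" "\<not> minimal_in (supp f) v" | "v \<notin> supp f"
        by blast
      then show ?thesis
      proof cases
        case 1
        then show ?thesis
          using enriched_transfer_nth[OF f, of v] enriched_transfer_nth[OF g, of v] eq supp by simp
      next
        case 2
        then show ?thesis
          using enriched_filters_values(3)[OF f, of v] enriched_filters_values(3)[OF g, of v] supp
          by simp
      next
        case 3
        then have "v \<notin> supp g" using supp by simp
        with 3 show ?thesis by (simp add: supp_def)
      qed
    qed
    then show "f = g" by (simp add: vec_eq_iff)
  qed
next
  show "enriched_transfer P ` enriched_filters P = enriched_antichains P"
  proof (intro equalityI subsetI)
    fix g assume "g \<in> enriched_transfer P ` enriched_filters P"
    then obtain f where f: "f \<in> enriched_filters P" and g: "g = enriched_transfer P f" by blast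
    have "antichain (supp g)"
      unfolding g supp_enriched_transfer[OF f] antichain_def by (auto simp: minimal_in_def)
    moreover have "g \<in> functions_on P"
      unfolding g functions_on_def enriched_transfer_def by simp
    moreover have "g $ v \<in> {1, 0, -1}" for v
      using enriched_filters_values(1)[OF f, of v] unfolding g enriched_transfer_nth[OF f] by simp
    ultimately show "g \<in> enriched_antichains P"
      unfolding enriched_antichains_def by blast
  next
    fix g assume g: "g \<in> enriched_antichains P"
    let ?F = "generated_filter P (supp g)"
    \<comment> \<open>The preimage of \<open>g\<close>: filling the rest of the filter with 1 leaves
      -1 only on \<open>supp g\<close>, whose elements are the minimal ones.\<close>
    define f where "f = (\<chi> v. if v \<in> supp g then g $ v else if v \<in> ?F then 1 else 0)"
    have sub: "supp g \<subseteq> P" and anti: "antichain (supp g)"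
      using g supp_subset unfolding enriched_antichains_def by blast+
    have subF: "supp g \<subseteq> ?F" by (rule subset_generated_filter)
    have F: "order_filter P ?F"
      unfolding generated_filter_eq[OF sub] order_filter_def
      by (auto dest: order_le_less_trans less_imp_le)
    have supp: "supp f = ?F"
      using subF by (auto simp: f_def supp_def)
    have min: "minimal_in (supp f) v \<longleftrightarrow> v \<in> supp g" for v
      unfolding supp by (rule minimal_in_generated_filter_iff[OF sub anti])
    have f: "f \<in> enriched_filters P"
    proof -
      have "f \<in> functions_on P"
        using F sub unfolding functions_on_def order_filter_def f_def by auto
      moreover have "f $ v \<in> {1, 0, -1}" if "v \<in> P" for v
        using g that unfolding enriched_antichains_def f_def by auto
      moreover have "minimal_in (supp f) v" if "f $ v = -1" for v
        unfolding min using that by (auto simp: f_def split: if_splits)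
      ultimately show ?thesis
        using F supp unfolding enriched_filters_def by simp
    qed
    have "enriched_transfer P f = g"
      unfolding vec_eq_iff enriched_transfer_nth[OF f] min by (simp add: f_def supp_def)
    then show "g \<in> enriched_transfer P ` enriched_filters P" using f by blast
  qed
qed

section \<open>Comparable filters and compatible antichains\<close>

text \<open>Exactly the failure of both generator conditions of the ideal.\<close>

definition compatible :: "'a::{finite,order} set \<Rightarrow> (real, 'a) vec \<Rightarrow> (real, 'a) vec \<Rightarrow> bool" where
  "compatible P g h \<longleftrightarrow>
     (generated_filter P (supp g) \<subseteq> generated_filter P (supp h) \<or>
      generated_filter P (supp h) \<subseteq> generated_filter P (supp g)) \<and>
     (\<forall>v\<in>supp g \<inter> supp h. g $ v = h $ v)"

text \<open>At a nonminimal element of \<open>supp f\<close> the value of \<open>f\<close> is 1,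
  which dominates \<open>g\<close>; at a minimal one the order demands equality, and there the
  transfer map keeps both values.\<close>

lemma enriched_greater_iff:
  assumes f: "f \<in> enriched_filters P" and g: "g \<in> enriched_filters P"
  shows "enriched_greater f g \<longleftrightarrow> supp g \<subset> supp f \<and>
    (\<forall>v\<in>supp (enriched_transfer P f) \<inter> supp (enriched_transfer P g).
       enriched_transfer P f $ v = enriched_transfer P g $ v)"
proof (cases "supp g \<subset> supp f")
  case True
  let ?T = "supp (enriched_transfer P f) \<inter> supp (enriched_transfer P g)"
  \<comment> \<open>An element of \<open>supp g\<close> that is minimal in the larger set
    \<open>supp f\<close> is also minimal in \<open>supp g\<close>.\<close>
  have T: "v \<in> ?T \<longleftrightarrow> v \<in> supp g \<and> minimal_in (supp f) v" for v
    using True unfolding supp_enriched_transfer[OF f] supp_enriched_transfer[OF g]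
    by (auto simp: minimal_in_def)
  have "enriched_transfer P f $ v = f $ v \<and> enriched_transfer P g $ v = g $ v" if "v \<in> ?T" for v
    using that unfolding supp_enriched_transfer[OF f] supp_enriched_transfer[OF g]
      enriched_transfer_nth[OF f] enriched_transfer_nth[OF g] by simp
  then have agree: "(\<forall>v\<in>?T. enriched_transfer P f $ v = enriched_transfer P g $ v) \<longleftrightarrow>
      (\<forall>v\<in>supp g. minimal_in (supp f) v \<longrightarrow> f $ v = g $ v)"
    using T by metis
  have "f $ v \<ge> g $ v" if "v \<in> supp g" "minimal_in (supp f) v \<longrightarrow> f $ v = g $ v" for v
  proof (cases "minimal_in (supp f) v")
    case False
    have "v \<in> supp f" using that(1) True by blast
    then show ?thesis
      using enriched_filters_values(3)[OF f _ False] enriched_filters_values(2)[OF g, of v] by simp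
  qed (use that(2) in simp)
  then show ?thesis
    unfolding agree enriched_greater_def using True by blast
qed (simp add: enriched_greater_def)

text \<open>The images generate the supports as filters, so only strictness of the inclusion is at
  issue: equal supports and agreeing images would force \<open>f = g\<close> by injectivity.\<close>

lemma comparable_iff_compatible:
  assumes f: "f \<in> enriched_filters P" and g: "g \<in> enriched_filters P" and "f \<noteq> g"
  shows "enriched_greater f g \<or> enriched_greater g f \<longleftrightarrow>
    compatible P (enriched_transfer P f) (enriched_transfer P g)"
proof -
  have "f = g" if supp: "supp f = supp g"
    and agree: "\<forall>v\<in>supp (enriched_transfer P f) \<inter> supp (enriched_transfer P g).
       enriched_transfer P f $ v = enriched_transfer P g $ v"
  proof -
    have "enriched_transfer P f $ v = enriched_transfer P g $ v" for v
      using agree unfolding supp_enriched_transfer[OF f] supp_enriched_transfer[OF g] supp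
        enriched_transfer_nth[OF f] enriched_transfer_nth[OF g] by auto
    then have "enriched_transfer P f = enriched_transfer P g" by (simp add: vec_eq_iff)
    then show ?thesis
      using bij_betw_enriched_transfer[of P] f g by (auto simp: bij_betw_def dest: inj_onD)
  qed
  then show ?thesis
    using \<open>f \<noteq> g\<close> enriched_greater_iff[OF f g] enriched_greater_iff[OF g f]
    unfolding compatible_def generated_filter_enriched_transfer[OF f]
      generated_filter_enriched_transfer[OF g] by (auto simp: psubset_eq)
qed

text \<open>Injectivity matches distinct images with distinct filters, so both sides are the same
  pairwise condition.\<close>

lemma chain_iff_flag:
  assumes "K \<subseteq> enriched_filters P"
  shows "pred_on.chain (enriched_filters P) enriched_greater K \<longleftrightarrow>
    enriched_transfer P ` K \<in> flag_complex (enriched_antichains P) (compatible P)"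
proof -
  have eq: "enriched_transfer P f = enriched_transfer P g \<longleftrightarrow> f = g" if "f \<in> K" "g \<in> K" for f g
    using that assms bij_betw_enriched_transfer[of P]
    by (auto simp: bij_betw_def inj_on_def)
  have "enriched_transfer P ` K \<subseteq> enriched_antichains P"
    using assms bij_betw_imp_surj_on[OF bij_betw_enriched_transfer] by blast
  moreover have "enriched_greater f g \<or> f = g \<or> enriched_greater g f \<longleftrightarrow>
    (f \<noteq> g \<longrightarrow> compatible P (enriched_transfer P f) (enriched_transfer P g))"
    if "f \<in> K" "g \<in> K" for f g
    using comparable_iff_compatible[of f P g] that assms by blast
  ultimately have "enriched_transfer P ` K \<in> flag_complex (enriched_antichains P) (compatible P)
      \<longleftrightarrow> (\<forall>f\<in>K. \<forall>g\<in>K. enriched_greater f g \<or> f = g \<or> enriched_greater g f)"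
    using eq unfolding flag_complex_def by simp
  then show ?thesis
    using assms unfolding pred_on.chain_def by auto
qed

section \<open>The ideal as the Stanley-Reisner ideal of a flag complex\<close>

lemma finite_enriched_antichains: "finite (enriched_antichains P)"
proof (rule finite_subset)
  show "enriched_antichains P \<subseteq> vec_lambda ` (UNIV \<rightarrow>\<^sub>E {1, 0, -1})"
  proof
    fix g assume "g \<in> enriched_antichains P"
    then have "vec_nth g \<in> UNIV \<rightarrow>\<^sub>E {1, 0, -1}"
      unfolding enriched_antichains_def functions_on_def by auto
    then show "g \<in> vec_lambda ` (UNIV \<rightarrow>\<^sub>E {1, 0, -1})"
      by (metis image_eqI vec_nth_inverse)
  qed
qed (simp add: finite_PiE)

lemma enriched_chain_ideal_eq:
  "(enriched_chain_ideal P :: ((real, 'a::{finite,order}) vec, 'k::field) polynomial set) =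
     stanley_reisner_ideal (enriched_antichains P)
       (flag_complex (enriched_antichains P) (compatible P))"
proof -
  have "(\<exists>v\<in>supp g \<inter> supp h. g $ v \<noteq> h $ v) \<or>
          (\<not> generated_filter P (supp g) \<subseteq> generated_filter P (supp h) \<and>
           \<not> generated_filter P (supp g) \<supseteq> generated_filter P (supp h) \<and>
           (\<forall>v\<in>supp g \<inter> supp h. g $ v = h $ v)) \<longleftrightarrow> \<not> compatible P g h" for g h
    unfolding compatible_def by blast
  then show ?thesis
    unfolding enriched_chain_ideal_def
    by (simp only: edge_ideal_eq_stanley_reisner_ideal[OF finite_enriched_antichains])
qed

section \<open>Affine independence of faces\<close>

text \<open>The support is recovered as the minimal elements of its filter, and compatibility fixes
  the values. Hence distinct members of a face have strictly nested filters.\<close>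

lemma compatible_same_filter:
  assumes g: "g \<in> enriched_antichains P" and h: "h \<in> enriched_antichains P"
    and comp: "compatible P g h"
    and eq: "generated_filter P (supp g) = generated_filter P (supp h)"
  shows "g = h"
proof -
  have min: "minimal_in (generated_filter P (supp x)) v \<longleftrightarrow> v \<in> supp x"
    if "x \<in> enriched_antichains P" for x v
    using that supp_subset[of x P] unfolding enriched_antichains_def
    by (intro minimal_in_generated_filter_iff) auto
  have supp: "supp g = supp h"
    using min[OF g] min[OF h] eq by auto
  have "g $ v = h $ v" for v
  proof (cases "v \<in> supp g")
    case True
    then show ?thesis using supp comp unfolding compatible_def by simp
  next
    case False
    moreover from this have "v \<notin> supp h" using supp by simp
    ultimately show ?thesis by (simp add: supp_def)
  qed
  then show ?thesis by (simp add: vec_eq_iff)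
qed

text \<open>The filters are pairwise nested and finite, so one of maximal cardinality contains all
  others.\<close>

lemma flag_has_greatest_filter:
  assumes "T \<in> flag_complex V (compatible P)" "finite T" "T \<noteq> {}"
  obtains g where "g \<in> T"
    "\<And>h. h \<in> T \<Longrightarrow> generated_filter P (supp h) \<subseteq> generated_filter P (supp g)"
proof -
  let ?c = "\<lambda>g. card (generated_filter P (supp g))"
  obtain g where g: "g \<in> T" "\<And>h. h \<in> T \<Longrightarrow> ?c h \<le> ?c g"
  proof -
    have "Max (?c ` T) \<in> ?c ` T" using assms(2,3) by (intro Max_in) auto
    then obtain g where "g \<in> T" "Max (?c ` T) = ?c g" by (rule imageE)
    moreover have "?c h \<le> Max (?c ` T)" if "h \<in> T" for h
      using assms(2) that by simp
    ultimately show thesis using that by auto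
  qed
  have "generated_filter P (supp h) \<subseteq> generated_filter P (supp g)" if h: "h \<in> T" for h
  proof (cases "h = g")
    case False
    then have "compatible P g h"
      using flag_complexD(2)[OF assms(1) g(1) h] by simp
    then show ?thesis
      using g(2)[OF h] card_seteq[of "generated_filter P (supp h)" "generated_filter P (supp g)"]
      unfolding compatible_def by auto
  qed simp
  then show thesis using that g(1) by blast
qed

text \<open>Among the vectors with nonzero coefficient, the one with the greatest filter has a
  support element outside all other filters; that coordinate isolates its coefficient.\<close>

lemma flag_affine_independent:
  assumes "\<sigma> \<in> flag_complex (enriched_antichains P) (compatible P)"
  shows "\<not> affine_dependent \<sigma>"
proof
  let ?V = "enriched_antichains P"
  let ?F = "\<lambda>g. generated_filter P (supp g)"
  assume "affine_dependent \<sigma>"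
  then obtain S U where S: "finite S" "S \<subseteq> \<sigma>" "sum U S = 0" "\<exists>v\<in>S. U v \<noteq> 0"
    and zero: "(\<Sum>g\<in>S. U g *\<^sub>R g) = 0"
    unfolding affine_dependent_explicit by blast
  define T where "T = {g \<in> S. U g \<noteq> 0}"
  have sub: "R \<in> flag_complex ?V (compatible P)" "finite R" if "R \<subseteq> T" for R
  proof -
    have R: "R \<subseteq> S" using that unfolding T_def by auto
    then show "finite R" using S(1) finite_subset by auto
    show "R \<in> flag_complex ?V (compatible P)"
      using assms simplicial_complex_on_flag_complex R S(2)
      unfolding simplicial_complex_on_def by (meson order_trans)
  qed
  obtain g where g: "g \<in> T" "\<And>h. h \<in> T \<Longrightarrow> ?F h \<subseteq> ?F g"
    using flag_has_greatest_filter[OF sub[OF order_refl]] S(4) unfolding T_def by blast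
  show False
  proof (cases "T - {g} = {}")
    \<comment> \<open>The only remaining vector \<open>g\<close> may be zero, so the contradiction
      comes from the coefficient sum, which equals \<open>U g\<close>.\<close>
    case True
    then have "sum U S = sum U {g}"
      using g(1) S(1) unfolding T_def by (intro sum.mono_neutral_right) auto
    then show False using S(3) g(1) unfolding T_def by simp
  next
    case False
    \<comment> \<open>The second greatest filter contains the supports of all vectors in
      \<open>T\<close> other than \<open>g\<close>.\<close>
    obtain h where h: "h \<in> T - {g}" "\<And>x. x \<in> T - {g} \<Longrightarrow> ?F x \<subseteq> ?F h"
    proof (rule flag_has_greatest_filter[OF sub[OF Diff_subset] False])
      fix h assume "h \<in> T - {g}" "\<And>x. x \<in> T - {g} \<Longrightarrow> ?F x \<subseteq> ?F h"
      then show thesis by (rule that)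
    qed
    have "g \<in> ?V" "h \<in> ?V"
      using flag_complexD(1)[OF sub(1)[OF order_refl]] g(1) h(1) by auto
    moreover have "compatible P g h"
      using flag_complexD(2)[OF sub(1)[OF order_refl], of g h] g(1) h(1) by auto
    ultimately have "?F g \<noteq> ?F h"
      using compatible_same_filter[of g P h] h(1) by auto
    then have nsub: "\<not> ?F g \<subseteq> ?F h" using g(2)[of h] h(1) by auto
    have supp: "supp x \<subseteq> P" if "x \<in> ?V" for x
      using that supp_subset[of x P] unfolding enriched_antichains_def by blast
    \<comment> \<open>If \<open>supp g\<close> lay in the filter of \<open>h\<close>, so would the
      filter it generates; hence some \<open>v\<close> in \<open>supp g\<close> escapes.\<close>
    have "?F g \<subseteq> ?F h" if "supp g \<subseteq> ?F h"
      using that unfolding generated_filter_eq[OF supp[OF \<open>g \<in> ?V\<close>]]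
        generated_filter_eq[OF supp[OF \<open>h \<in> ?V\<close>]] by (auto dest: order_trans)
    then obtain v where v: "v \<in> supp g" "v \<notin> ?F h" using nsub by blast
    have "x $ v = 0" if "x \<in> T - {g}" for x
    proof -
      have "supp x \<subseteq> ?F h"
        using subset_generated_filter h(2)[OF that] by (rule subset_trans)
      then show ?thesis using v(2) unfolding supp_def by auto
    qed
    then have "(\<Sum>x\<in>S. U x * x $ v) = (\<Sum>x\<in>{g}. U x * x $ v)"
      using g(1) S(1) unfolding T_def by (intro sum.mono_neutral_right) auto
    moreover have "(\<Sum>x\<in>S. U x * x $ v) = 0"
      using arg_cong[OF zero, of "\<lambda>x. x $ v"] by simp
    ultimately show False using g(1) v(1) unfolding T_def supp_def by simp
  qed
qed

text \<open>An affinely independent set is recovered as the extreme points of its hull.\<close>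

lemma inj_on_convex_hull_affine_independent:
  fixes \<Delta> :: "'b::euclidean_space set set"
  assumes "\<And>\<sigma>. \<sigma> \<in> \<Delta> \<Longrightarrow> \<not> affine_dependent \<sigma>"
  shows "inj_on (\<lambda>\<sigma>. convex hull \<sigma>) \<Delta>"
proof (rule inj_onI)
  fix \<sigma> \<tau> assume faces: "\<sigma> \<in> \<Delta>" "\<tau> \<in> \<Delta>" and eq: "convex hull \<sigma> = convex hull \<tau>"
  have "x \<in> \<sigma> \<longleftrightarrow> x extreme_point_of (convex hull \<sigma>)" for x
    using extreme_point_of_convex_hull_affine_independent[OF assms[OF faces(1)]] by simp
  moreover have "x \<in> \<tau> \<longleftrightarrow> x extreme_point_of (convex hull \<tau>)" for x
    using extreme_point_of_convex_hull_affine_independent[OF assms[OF faces(2)]] by simp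
  ultimately show "\<sigma> = \<tau>"
    unfolding eq by auto
qed

section \<open>Faces and simplices\<close>

lemma enriched_triangulation_eq:
  "enriched_triangulation P =
     (\<lambda>\<sigma>. convex hull \<sigma>) ` flag_complex (enriched_antichains P) (compatible P)"
proof (intro equalityI subsetI)
  fix X assume "X \<in> enriched_triangulation P"
  then obtain K where K: "X = convex hull (enriched_transfer P ` K)"
    "pred_on.chain (enriched_filters P) enriched_greater K"
    unfolding enriched_triangulation_def by blast
  then show "X \<in> (\<lambda>\<sigma>. convex hull \<sigma>) ` flag_complex (enriched_antichains P) (compatible P)"
    using chain_iff_flag[of K P] by (simp add: pred_on.chain_def)
next
  fix X assume "X \<in> (\<lambda>\<sigma>. convex hull \<sigma>) ` flag_complex (enriched_antichains P) (compatible P)"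
  then obtain \<sigma> where \<sigma>: "X = convex hull \<sigma>"
    "\<sigma> \<in> flag_complex (enriched_antichains P) (compatible P)" by blast
  \<comment> \<open>Surjectivity of the transfer map lifts the face to a set \<open>K\<close> of
    filters, which is then a chain.\<close>
  then have "\<sigma> \<subseteq> enriched_transfer P ` enriched_filters P"
    unfolding bij_betw_imp_surj_on[OF bij_betw_enriched_transfer] flag_complex_def by blast
  then obtain K where "K \<subseteq> enriched_filters P" "\<sigma> = enriched_transfer P ` K"
    by (auto simp: subset_image_iff)
  then show "X \<in> enriched_triangulation P"
    using \<sigma> chain_iff_flag[of K P] unfolding enriched_triangulation_def by blast
qed

text \<open>The two conjuncts make the identification of a face with its hull precise: affine
  independence makes the hull a simplex with the face as vertex set, and the bijection matches faces
  with members of the triangulation. The empty face corresponds to the empty chain.\<close>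

theorem proposition4p4:
  fixes P :: "'a::{finite,order} set"
  shows "let \<Delta> = stanley_reisner_complex (enriched_antichains P)
                    (enriched_chain_ideal P :: ((real, 'a) vec, 'k::field) polynomial set)
         in (\<forall>\<sigma>\<in>\<Delta>. \<not> affine_dependent \<sigma>) \<and>
            bij_betw (\<lambda>\<sigma>. convex hull \<sigma>) \<Delta> (enriched_triangulation P)"
proof -
  let ?\<Delta> = "flag_complex (enriched_antichains P) (compatible P)"
  have "stanley_reisner_complex (enriched_antichains P)
          (enriched_chain_ideal P :: ((real, 'a) vec, 'k) polynomial set) = ?\<Delta>"
    unfolding enriched_chain_ideal_eq
    by (rule stanley_reisner_complex_of_ideal[OF finite_enriched_antichains
          simplicial_complex_on_flag_complex])
  moreover have "bij_betw (\<lambda>\<sigma>. convex hull \<sigma>) ?\<Delta> (enriched_triangulation P)"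
    unfolding bij_betw_def enriched_triangulation_eq
    by (auto intro!: inj_on_convex_hull_affine_independent dest: flag_affine_independent)
  ultimately show ?thesis
    by (auto simp: Let_def dest: flag_affine_independent)
qed

end
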